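(* Let $(A,d)$ be a diffuse metric space. Then $(\mathcal{D}(A),\mathrm{LK}_d,\{+_p\}_{p\in(0,1)})$, where $\mu+_p\nu=p\mu+(1-p)\nu$, is the free algebra on $(A,d)$ in $\mathbf{Alg}(\widehat\Sigma_{\mathrm{LK}},E)$: it belongs to $\mathbf{Alg}(\widehat\Sigma_{\mathrm{LK}},E)$, the map $\eta:a\mapsto\delta_a$ is nonexpansive $(A,d)\to(\mathcal{D}(A),\mathrm{LK}_d)$, and for every $(B,\Delta,\{[\![+_p]\!]_B\})\in\mathbf{Alg}(\widehat\Sigma_{\mathrm{LK}},E)$ and every nonexpansive $f:(A,d)\to(B,\Delta)$ there is a unique homomorphism $f^*:\mathcal{D}(A)\to B$ in $\mathbf{Alg}(\widehat\Sigma_{\mathrm{LK}},E)$ with $f^*\circ\eta=f$.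
   Context: A diffuse metric space is a set $A$ with $d:A\times A\to[0,1]$ satisfying $d(a,b)=d(b,a)$ and $d(a,c)\le d(a,b)+d(b,c)$; $\mathbf{DMet}$ is the category of these with nonexpansive maps ($\Delta(f(a),f(a'))\le d(a,a')$). $\mathcal{D}(A)$ is the set of finitely supported probability distributions on $A$, $\delta_a$ the Dirac distribution, and $\mathrm{LK}_d(\mu,\nu)=\sum_{x\in\mathrm{supp}(\mu)}\sum_{y\in\mathrm{supp}(\nu)}\mu(x)\nu(y)d(x,y)$. For $p\in(0,1)$ and a diffuse metric space $(B,\Delta)$, $L^p_{\mathrm{LK}}(\Delta)$ is the fuzzy relation on $B\times B$ with $L^p_{\mathrm{LK}}(\Delta)((b_1,b_2),(c_1,c_2))=\mathrm{LK}_\Delta(p\delta_{b_1}+(1-p)\delta_{b_2},\,p\delta_{c_1}+(1-p)\delta_{c_2})$. $\mathbf{Alg}(\widehat\Sigma_{\mathrm{LK}},E)$ is the category whose objects are diffuse metric spaces $(B,\Delta)$ equipped with binary operations $[\![+_p]\!]_B:B\times B\to B$ ($p\in(0,1)$) such that each $[\![+_p]\!]_B$ is nonexpansive from $(B\times B,L^p_{\mathrm{LK}}(\Delta))$ to $(B,\Delta)$ and the convex algebra axioms hold: $x+_px=x$, $x+_py=y+_{1-p}x$, $(x+_qy)+_pz=x+_{pq}(y+_{\frac{p(1-q)}{1-pq}}z)$; morphisms are nonexpansive maps preserving all $+_p$. *)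

theory Defs
  imports "HOL-Probability.Probability_Mass_Function"
begin

text \<open>
  All structures live on carrier sets inside a type, so the empty space is included. Distances
  and operations are total HOL functions of which only the values on the carrier matter; the
  operations are indexed by a real of which only the values strictly between 0 and 1 matter.
\<close>

definition fuzzy_relation :: "'a set \<Rightarrow> ('a \<Rightarrow> 'a \<Rightarrow> real) \<Rightarrow> bool" where
  "fuzzy_relation A d \<longleftrightarrow> (\<forall>a\<in>A. \<forall>b\<in>A. d a b \<in> {0..1})"

definition diffuse_metric_space :: "'a set \<Rightarrow> ('a \<Rightarrow> 'a \<Rightarrow> real) \<Rightarrow> bool" where
  "diffuse_metric_space A d \<longleftrightarrow>
     fuzzy_relation A d \<and>
     (\<forall>a\<in>A. \<forall>b\<in>A. d a b = d b a) \<and>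
     (\<forall>a\<in>A. \<forall>b\<in>A. \<forall>c\<in>A. d a c \<le> d a b + d b c)"

definition nonexpansive ::
  "'a set \<Rightarrow> ('a \<Rightarrow> 'a \<Rightarrow> real) \<Rightarrow> 'b set \<Rightarrow> ('b \<Rightarrow> 'b \<Rightarrow> real) \<Rightarrow> ('a \<Rightarrow> 'b) \<Rightarrow> bool" where
  "nonexpansive A d B \<Delta> f \<longleftrightarrow>
     f \<in> A \<rightarrow> B \<and> (\<forall>a\<in>A. \<forall>a'\<in>A. \<Delta> (f a) (f a') \<le> d a a')"

definition fin_distributions :: "'a set \<Rightarrow> 'a pmf set" where
  "fin_distributions A = {\<mu>. finite (set_pmf \<mu>) \<and> set_pmf \<mu> \<subseteq> A}"

definition LK :: "('a \<Rightarrow> 'a \<Rightarrow> real) \<Rightarrow> 'a pmf \<Rightarrow> 'a pmf \<Rightarrow> real" where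
  "LK d \<mu> \<nu> = (\<Sum>x\<in>set_pmf \<mu>. \<Sum>y\<in>set_pmf \<nu>. pmf \<mu> x * pmf \<nu> y * d x y)"

definition mix :: "real \<Rightarrow> 'a pmf \<Rightarrow> 'a pmf \<Rightarrow> 'a pmf" where
  "mix p \<mu> \<nu> = bind_pmf (bernoulli_pmf p) (\<lambda>b. if b then \<mu> else \<nu>)"

lemma pmf_mix:
  assumes "0 < p" "p < 1"
  shows "pmf (mix p \<mu> \<nu>) x = p * pmf \<mu> x + (1 - p) * pmf \<nu> x"
  using assms by (simp add: mix_def pmf_bind)

definition lift_LK ::
  "real \<Rightarrow> ('b \<Rightarrow> 'b \<Rightarrow> real) \<Rightarrow> 'b \<times> 'b \<Rightarrow> 'b \<times> 'b \<Rightarrow> real" where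
  "lift_LK p \<Delta> = (\<lambda>(b1, b2) (c1, c2).
     LK \<Delta> (mix p (return_pmf b1) (return_pmf b2)) (mix p (return_pmf c1) (return_pmf c2)))"

definition convex_algebra :: "'b set \<Rightarrow> (real \<Rightarrow> 'b \<Rightarrow> 'b \<Rightarrow> 'b) \<Rightarrow> bool" where
  "convex_algebra B pl \<longleftrightarrow>
     (\<forall>p\<in>{0<..<1}. \<forall>x\<in>B. \<forall>y\<in>B. pl p x y \<in> B) \<and>
     (\<forall>p\<in>{0<..<1}. \<forall>x\<in>B. pl p x x = x) \<and>
     (\<forall>p\<in>{0<..<1}. \<forall>x\<in>B. \<forall>y\<in>B. pl p x y = pl (1 - p) y x) \<and>
     (\<forall>p\<in>{0<..<1}. \<forall>q\<in>{0<..<1}. \<forall>x\<in>B. \<forall>y\<in>B. \<forall>z\<in>B.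
        pl p (pl q x y) z = pl (p * q) x (pl (p * (1 - q) / (1 - p * q)) y z))"

definition LK_algebra ::
  "'b set \<Rightarrow> ('b \<Rightarrow> 'b \<Rightarrow> real) \<Rightarrow> (real \<Rightarrow> 'b \<Rightarrow> 'b \<Rightarrow> 'b) \<Rightarrow> bool" where
  "LK_algebra B \<Delta> pl \<longleftrightarrow>
     diffuse_metric_space B \<Delta> \<and>
     convex_algebra B pl \<and>
     (\<forall>p\<in>{0<..<1}. nonexpansive (B \<times> B) (lift_LK p \<Delta>) B \<Delta> (\<lambda>(x, y). pl p x y))"

definition LK_hom ::
  "'b set \<Rightarrow> ('b \<Rightarrow> 'b \<Rightarrow> real) \<Rightarrow> (real \<Rightarrow> 'b \<Rightarrow> 'b \<Rightarrow> 'b) \<Rightarrow>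
   'c set \<Rightarrow> ('c \<Rightarrow> 'c \<Rightarrow> real) \<Rightarrow> (real \<Rightarrow> 'c \<Rightarrow> 'c \<Rightarrow> 'c) \<Rightarrow> ('b \<Rightarrow> 'c) \<Rightarrow> bool" where
  "LK_hom B \<Delta> plB C \<Gamma> plC h \<longleftrightarrow>
     nonexpansive B \<Delta> C \<Gamma> h \<and>
     (\<forall>p\<in>{0<..<1}. \<forall>x\<in>B. \<forall>y\<in>B. h (plB p x y) = plC p (h x) (h y))"

end

theory Submission
  imports Defs "HOL-Algebra.FiniteProduct"
begin

text \<open>
  A convex algebra \<open>B\<close> embeds, as the elements of mass 1, into the commutative monoid of formal
  scalar multiples \<open>r x\<close> with \<open>r > 0\<close>, together with a zero, under
  \<open>r x + s y = (r + s) (x +\<^sub>p y)\<close> for \<open>p = r / (r + s)\<close>. The homomorphism extending \<open>f\<close> sends \<open>\<mu>\<close>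
  to the finite sum of the multiples \<open>\<mu>(a) f(a)\<close>; being a sum in a commutative monoid, it does not
  depend on any order of summation. Uniqueness and nonexpansiveness both follow from the fact that
  Dirac distributions generate all finitely supported ones under mixing: for the latter,
  idempotence turns the nonexpansiveness of \<open>+\<^sub>p\<close> into
  \<open>\<Delta>(x +\<^sub>p y, z) \<le> p \<Delta>(x, z) + (1 - p) \<Delta>(y, z)\<close>, and \<open>LK\<close> is affine in each argument.
\<close>

subsection \<open>Mixtures of finitely supported distributions\<close>

lemma set_pmf_mix:
  assumes "0 < p" "p < 1"
  shows "set_pmf (mix p \<mu> \<nu>) = set_pmf \<mu> \<union> set_pmf \<nu>"
  using assms by (auto simp: mix_def split: if_splits)

lemma mix_fin_distributions:
  assumes "0 < p" "p < 1" "\<mu> \<in> fin_distributions A" "\<nu> \<in> fin_distributions A"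
  shows "mix p \<mu> \<nu> \<in> fin_distributions A"
  using assms by (auto simp: fin_distributions_def set_pmf_mix)

lemma return_pmf_fin_distributions: "a \<in> A \<Longrightarrow> return_pmf a \<in> fin_distributions A"
  by (simp add: fin_distributions_def)

lemma convex_algebra_mix: "convex_algebra (fin_distributions A) mix"
proof -
  have assoc: "mix p (mix q x y) z = mix (p * q) x (mix (p * (1 - q) / (1 - p * q)) y z)"
    if p: "0 < p" "p < 1" and q: "0 < q" "q < 1" for p q and x y z :: "'a pmf"
  proof (rule pmf_eqI)
    fix i
    have pq: "0 < p * q" "p * q < 1"
      using p q mult_strict_mono[of p 1 q 1] by auto
    have "p * (1 - q) < 1 - p * q" using p by (simp add: algebra_simps)
    then have r: "0 < p * (1 - q) / (1 - p * q)" "p * (1 - q) / (1 - p * q) < 1"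
      using p q pq by (auto simp: divide_simps)
    \<comment> \<open>Multiplied by the outer weight \<open>1 - p * q\<close>, the inner weight and
      its complement lose their denominators and give the total weights of \<open>y\<close> and
      \<open>z\<close>.\<close>
    have "(1 - p * q) * (p * (1 - q) / (1 - p * q)) = p * (1 - q)"
      and "(1 - p * q) * (1 - p * (1 - q) / (1 - p * q)) = 1 - p"
      using pq by (auto simp: field_simps)
    then have "(1 - p * q) * (p * (1 - q) / (1 - p * q) * pmf y i
        + (1 - p * (1 - q) / (1 - p * q)) * pmf z i) = p * (1 - q) * pmf y i + (1 - p) * pmf z i"
      by (simp only: distrib_left mult.assoc[symmetric])
    then show "pmf (mix p (mix q x y) z) i
        = pmf (mix (p * q) x (mix (p * (1 - q) / (1 - p * q)) y z)) i"
      unfolding pmf_mix[OF p] pmf_mix[OF q] pmf_mix[OF pq] pmf_mix[OF r]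
      by (simp add: algebra_simps)
  qed
  show ?thesis
    unfolding convex_algebra_def
  proof (intro conjI ballI)
    fix p q :: real and x y z :: "'a pmf"
    assume "p \<in> {0<..<1}"
    then have p: "0 < p" "p < 1" and p': "0 < 1 - p" "1 - p < 1" by auto
    show "mix p x x = x"
      by (rule pmf_eqI) (simp add: pmf_mix[OF p] algebra_simps)
    show "mix p x y = mix (1 - p) y x"
      by (rule pmf_eqI) (simp only: pmf_mix[OF p] pmf_mix[OF p'], simp)
    show "mix p (mix q x y) z = mix (p * q) x (mix (p * (1 - q) / (1 - p * q)) y z)"
      if "q \<in> {0<..<1}"
      using that p by (intro assoc) auto
    show "mix p x y \<in> fin_distributions A" if "x \<in> fin_distributions A" "y \<in> fin_distributions A"
      using p that by (rule mix_fin_distributions)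
  qed
qed

text \<open>Unless \<open>\<mu>\<close> is Dirac, any support point \<open>a\<close> splits off:
  \<open>\<mu>\<close> mixes the Dirac distribution at \<open>a\<close>, weighted by the probability
  of \<open>a\<close>, with \<open>\<mu>\<close> conditioned on the complement of \<open>a\<close>,
  whose support is one point smaller.\<close>

lemma fin_distributions_induct [consumes 1, case_names return mix]:
  assumes "\<mu> \<in> fin_distributions A"
    and ret: "\<And>a. a \<in> A \<Longrightarrow> P (return_pmf a)"
    and mix: "\<And>p \<mu> \<nu>. \<lbrakk>0 < p; p < 1; \<mu> \<in> fin_distributions A; \<nu> \<in> fin_distributions A; P \<mu>; P \<nu>\<rbrakk>
      \<Longrightarrow> P (mix p \<mu> \<nu>)"
  shows "P \<mu>"
  using assms(1)
proof (induction "card (set_pmf \<mu>)" arbitrary: \<mu> rule: less_induct)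
  case less
  have fin: "finite (set_pmf \<mu>)" and sub: "set_pmf \<mu> \<subseteq> A"
    using less.prems by (auto simp: fin_distributions_def)
  obtain a where a: "a \<in> set_pmf \<mu>" using set_pmf_not_empty by fast
  show ?case
  proof (cases "set_pmf \<mu> = {a}")
    case True
    then have "\<mu> = return_pmf a" using set_pmf_subset_singleton[of \<mu> a] by simp
    then show ?thesis using ret a sub by auto
  next
    case False
    define p where "p = pmf \<mu> a"
    define \<nu> where "\<nu> = cond_pmf \<mu> (- {a})"
    \<comment> \<open>A second support point makes the conditioning meaningful and forces
      \<open>p < 1\<close>.\<close>
    have ne: "set_pmf \<mu> \<inter> - {a} \<noteq> {}" using False a by auto
    have p0: "0 < p" using a by (simp add: p_def pmf_positive)
    have "measure \<mu> (- {a}) = 1 - p"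
      unfolding p_def by (simp add: measure_pmf.prob_compl[of "{a}", simplified] Compl_eq_Diff_UNIV
          measure_pmf_single)
    moreover have "measure \<mu> (- {a}) > 0"
      using ne by (meson Int_emptyI measure_pmf_posI disjoint_iff)
    ultimately have p1: "p < 1" and meas: "measure \<mu> (- {a}) = 1 - p" by auto
    have set\<nu>: "set_pmf \<nu> = set_pmf \<mu> - {a}"
      unfolding \<nu>_def using set_cond_pmf[OF ne] by auto
    have \<nu>: "\<nu> \<in> fin_distributions A" using fin sub set\<nu> by (auto simp: fin_distributions_def)
    have "card (set_pmf \<nu>) < card (set_pmf \<mu>)"
      using fin a set\<nu> by (metis card_Diff1_less)
    then have "P \<nu>" using less.hyps \<nu> by blast
    moreover have "\<mu> = mix p (return_pmf a) \<nu>"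
    proof (rule pmf_eqI)
      fix i show "pmf \<mu> i = pmf (mix p (return_pmf a) \<nu>) i"
        unfolding pmf_mix[OF p0 p1] \<nu>_def pmf_cond[OF ne] meas using p1 by (simp add: p_def)
    qed
    ultimately show ?thesis
      using mix[OF p0 p1 _ \<nu>, of "return_pmf a"] ret a sub
      by (auto intro: return_pmf_fin_distributions)
  qed
qed

subsection \<open>The Lukaszyk--Karmowski distance\<close>

text \<open>Summands off the supports vanish. Distributions with different supports can thus be
  summed over one common index set.\<close>

lemma LK_superset:
  assumes "finite F" "set_pmf \<mu> \<subseteq> F" "finite G" "set_pmf \<nu> \<subseteq> G"
  shows "LK d \<mu> \<nu> = (\<Sum>x\<in>F. \<Sum>y\<in>G. pmf \<mu> x * pmf \<nu> y * d x y)"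
proof -
  have "(\<Sum>y\<in>set_pmf \<nu>. pmf \<mu> x * pmf \<nu> y * d x y) = (\<Sum>y\<in>G. pmf \<mu> x * pmf \<nu> y * d x y)" for x
    using assms by (intro sum.mono_neutral_left) (auto simp: set_pmf_iff)
  then have "LK d \<mu> \<nu> = (\<Sum>x\<in>set_pmf \<mu>. \<Sum>y\<in>G. pmf \<mu> x * pmf \<nu> y * d x y)"
    by (simp add: LK_def)
  also have "\<dots> = (\<Sum>x\<in>F. \<Sum>y\<in>G. pmf \<mu> x * pmf \<nu> y * d x y)"
    using assms by (intro sum.mono_neutral_left) (auto simp: set_pmf_iff)
  finally show ?thesis .
qed

lemma LK_return: "LK d (return_pmf a) (return_pmf b) = d a b"
  by (simp add: LK_def)

lemma LK_mix_left:
  assumes p: "0 < p" "p < 1"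
    and fin: "finite (set_pmf \<mu>)" "finite (set_pmf \<nu>)" "finite (set_pmf \<rho>)"
  shows "LK d (mix p \<mu> \<nu>) \<rho> = p * LK d \<mu> \<rho> + (1 - p) * LK d \<nu> \<rho>"
proof -
  let ?F = "set_pmf \<mu> \<union> set_pmf \<nu>"
  have "LK d \<kappa> \<rho> = (\<Sum>x\<in>?F. \<Sum>y\<in>set_pmf \<rho>. pmf \<kappa> x * pmf \<rho> y * d x y)"
    if "set_pmf \<kappa> \<subseteq> ?F" for \<kappa>
    using fin that by (intro LK_superset) auto
  then show ?thesis
    using p by (simp add: set_pmf_mix pmf_mix sum_distrib_left flip: sum.distrib)
      (simp add: algebra_simps)
qed

lemma LK_mix_right:
  assumes p: "0 < p" "p < 1"
    and fin: "finite (set_pmf \<mu>)" "finite (set_pmf \<nu>)" "finite (set_pmf \<rho>)"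
  shows "LK d \<rho> (mix p \<mu> \<nu>) = p * LK d \<rho> \<mu> + (1 - p) * LK d \<rho> \<nu>"
proof -
  \<comment> \<open>Exchanging the arguments transposes \<open>d\<close>, so affinity on the right
    is affinity on the left for the transposed function.\<close>
  have flip: "LK d \<kappa> \<kappa>' = LK (\<lambda>x y. d y x) \<kappa>' \<kappa>" for \<kappa> \<kappa>' :: "'a pmf"
    unfolding LK_def by (subst sum.swap) (simp add: mult.commute)
  show ?thesis unfolding flip using LK_mix_left[OF assms] by simp
qed

text \<open>Expanding by affinity rather than over the supports also covers \<open>b1 = b2\<close>
  and \<open>c1 = c2\<close>, where a support shrinks to one point.\<close>

lemma lift_LK_eq:
  assumes p: "0 < p" "p < 1"
  shows "lift_LK p \<Delta> (b1, b2) (c1, c2) =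
    p * (p * \<Delta> b1 c1 + (1 - p) * \<Delta> b1 c2) + (1 - p) * (p * \<Delta> b2 c1 + (1 - p) * \<Delta> b2 c2)"
  using p by (simp add: lift_LK_def LK_mix_left LK_mix_right LK_return set_pmf_mix)
    (simp add: algebra_simps)

text \<open>The values lie in the unit interval as iterated convex combinations of distances between
  points. For the triangle inequality, draw independent points with laws \<open>\<mu>\<close>,
  \<open>\<nu>\<close>, \<open>\<rho>\<close> and average the pointwise inequality.\<close>

lemma diffuse_metric_space_LK:
  assumes "diffuse_metric_space A d"
  shows "diffuse_metric_space (fin_distributions A) (LK d)"
proof -
  have d01: "\<And>a b. a \<in> A \<Longrightarrow> b \<in> A \<Longrightarrow> 0 \<le> d a b \<and> d a b \<le> 1"
    and sym: "\<And>a b. a \<in> A \<Longrightarrow> b \<in> A \<Longrightarrow> d a b = d b a"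
    and tri: "\<And>a b c. a \<in> A \<Longrightarrow> b \<in> A \<Longrightarrow> c \<in> A \<Longrightarrow> d a c \<le> d a b + d b c"
    using assms by (auto simp: diffuse_metric_space_def fuzzy_relation_def)
  have D: "finite (set_pmf \<mu>)" "set_pmf \<mu> \<subseteq> A" if "\<mu> \<in> fin_distributions A" for \<mu>
    using that by (auto simp: fin_distributions_def)
  have range: "LK d \<mu> \<nu> \<in> {0..1}"
    if \<mu>: "\<mu> \<in> fin_distributions A" and \<nu>: "\<nu> \<in> fin_distributions A" for \<mu> \<nu>
    using \<mu>
  proof (induction rule: fin_distributions_induct)
    case (return a)
    from \<nu> show ?case
    proof (induction rule: fin_distributions_induct)
      case (return b)
      then show ?case using \<open>a \<in> A\<close> d01 by (simp add: LK_return)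
    next
      case (mix p \<nu> \<nu>')
      then have "LK d (return_pmf a) (mix p \<nu> \<nu>') =
          p * LK d (return_pmf a) \<nu> + (1 - p) * LK d (return_pmf a) \<nu>'"
        by (intro LK_mix_right) (auto simp: D)
      then show ?case using mix by (auto intro: convex_bound_le)
    qed
  next
    case (mix p \<mu> \<mu>')
    then have "LK d (mix p \<mu> \<mu>') \<nu> = p * LK d \<mu> \<nu> + (1 - p) * LK d \<mu>' \<nu>"
      using \<nu> by (intro LK_mix_left) (auto simp: D)
    then show ?case using mix by (auto intro: convex_bound_le)
  qed
  have symLK: "LK d \<mu> \<nu> = LK d \<nu> \<mu>"
    if "\<mu> \<in> fin_distributions A" "\<nu> \<in> fin_distributions A" for \<mu> \<nu>
    unfolding LK_def using D[OF that(1)] D[OF that(2)] sym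
    by (subst sum.swap, intro sum.cong refl) (auto simp: mult.commute mult.left_commute)
  have triLK: "LK d \<mu> \<rho> \<le> LK d \<mu> \<nu> + LK d \<nu> \<rho>"
    if \<mu>: "\<mu> \<in> fin_distributions A" and \<nu>: "\<nu> \<in> fin_distributions A"
      and \<rho>: "\<rho> \<in> fin_distributions A" for \<mu> \<nu> \<rho>
  proof -
    define F where "F = set_pmf \<mu> \<union> set_pmf \<nu> \<union> set_pmf \<rho>"
    have F: "finite F" "F \<subseteq> A" using D \<mu> \<nu> \<rho> by (auto simp: F_def)
    have sub: "set_pmf \<mu> \<subseteq> F" "set_pmf \<nu> \<subseteq> F" "set_pmf \<rho> \<subseteq> F" by (auto simp: F_def)
    have one: "(\<Sum>x\<in>F. pmf \<kappa> x) = 1" if "set_pmf \<kappa> \<subseteq> F" for \<kappa>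
      using F that by (intro sum_pmf_eq_1) auto
    have LKF: "LK d \<kappa> \<kappa>' = (\<Sum>x\<in>F. \<Sum>y\<in>F. pmf \<kappa> x * pmf \<kappa>' y * d x y)"
      if "set_pmf \<kappa> \<subseteq> F" "set_pmf \<kappa>' \<subseteq> F" for \<kappa> \<kappa>'
      using F that by (intro LK_superset) auto
    \<comment> \<open>The total mass of \<open>\<nu>\<close> enters as a factor 1, so that the
      middle point is summed over as well.\<close>
    have "LK d \<mu> \<rho> = (\<Sum>y\<in>F. pmf \<nu> y) * LK d \<mu> \<rho>" by (simp add: one sub)
    also have "\<dots> = (\<Sum>y\<in>F. \<Sum>x\<in>F. \<Sum>z\<in>F. pmf \<nu> y * (pmf \<mu> x * pmf \<rho> z * d x z))"
      by (simp only: sum_distrib_right) (simp add: LKF sub sum_distrib_left)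
    also have "\<dots> \<le> (\<Sum>y\<in>F. \<Sum>x\<in>F. \<Sum>z\<in>F. pmf \<nu> y * (pmf \<mu> x * pmf \<rho> z * (d x y + d y z)))"
      using F by (intro sum_mono mult_left_mono tri) auto
    \<comment> \<open>In each of the two sums one law no longer touches the distance; its total mass
      1 is factored out below.\<close>
    also have "\<dots> = (\<Sum>y\<in>F. \<Sum>x\<in>F. \<Sum>z\<in>F. pmf \<mu> x * pmf \<nu> y * d x y * pmf \<rho> z)
        + (\<Sum>y\<in>F. \<Sum>x\<in>F. \<Sum>z\<in>F. pmf \<mu> x * (pmf \<nu> y * pmf \<rho> z * d y z))"
      by (simp add: algebra_simps sum.distrib)
    also have "(\<Sum>y\<in>F. \<Sum>x\<in>F. \<Sum>z\<in>F. pmf \<mu> x * pmf \<nu> y * d x y * pmf \<rho> z) = LK d \<mu> \<nu>"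
      by (subst sum.swap) (simp add: LKF one sub flip: sum_distrib_left)
    also have "(\<Sum>y\<in>F. \<Sum>x\<in>F. \<Sum>z\<in>F. pmf \<mu> x * (pmf \<nu> y * pmf \<rho> z * d y z))
        = (\<Sum>y\<in>F. (\<Sum>x\<in>F. pmf \<mu> x) * (\<Sum>z\<in>F. pmf \<nu> y * pmf \<rho> z * d y z))"
      by (simp only: sum_product)
    also have "\<dots> = LK d \<nu> \<rho>"
      by (simp add: LKF one sub)
    finally show ?thesis .
  qed
  show ?thesis
    unfolding diffuse_metric_space_def fuzzy_relation_def using range symLK triLK by blast
qed

text \<open>By affinity in both arguments, the distance of two mixtures equals the lifted distance,
  so nonexpansiveness of \<open>mix\<close> holds with equality.\<close>

lemma LK_algebra_fin_distributions:
  assumes "diffuse_metric_space A d"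
  shows "LK_algebra (fin_distributions A) (LK d) mix"
proof -
  have "LK d (mix p \<mu> \<nu>) (mix p \<mu>' \<nu>') = lift_LK p (LK d) (\<mu>, \<nu>) (\<mu>', \<nu>')"
    if p: "0 < p" "p < 1" and "\<mu> \<in> fin_distributions A" "\<nu> \<in> fin_distributions A"
      "\<mu>' \<in> fin_distributions A" "\<nu>' \<in> fin_distributions A" for p \<mu> \<nu> \<mu>' \<nu>'
    using that unfolding lift_LK_eq[OF p]
    by (simp add: LK_mix_left LK_mix_right fin_distributions_def set_pmf_mix)
      (simp add: algebra_simps)
  then show ?thesis
    using diffuse_metric_space_LK[OF assms] convex_algebra_mix[of A]
    unfolding LK_algebra_def nonexpansive_def by (auto intro: mix_fin_distributions)
qed

subsection \<open>The cone over a convex algebra\<close>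

text \<open>\<open>None\<close> is the zero of the cone. Keeping it apart from the pairs leaves
  \<open>r / (r + s)\<close> strictly between 0 and 1 for positive masses, where the axioms govern
  \<open>pl\<close>.\<close>

fun cone_add ::
  "(real \<Rightarrow> 'b \<Rightarrow> 'b \<Rightarrow> 'b) \<Rightarrow> (real \<times> 'b) option \<Rightarrow> (real \<times> 'b) option \<Rightarrow> (real \<times> 'b) option" where
  "cone_add pl None v = v"
| "cone_add pl u None = u"
| "cone_add pl (Some (r, x)) (Some (s, y)) = Some (r + s, pl (r / (r + s)) x y)"

lemma cone_add_None_right [simp]: "cone_add pl u None = u"
  by (cases u) auto

definition cone_monoid :: "'b set \<Rightarrow> (real \<Rightarrow> 'b \<Rightarrow> 'b \<Rightarrow> 'b) \<Rightarrow> (real \<times> 'b) option monoid" where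
  "cone_monoid B pl = \<lparr>carrier = insert None (Some ` ({0<..} \<times> B)), mult = cone_add pl, one = None\<rparr>"

text \<open>Coefficient 0 gives the unit, so points outside a support contribute nothing to a
  sum.\<close>

definition cone_pt :: "real \<Rightarrow> 'b \<Rightarrow> (real \<times> 'b) option" where
  "cone_pt r x = (if r = 0 then None else Some (r, x))"

definition cone_scale :: "real \<Rightarrow> (real \<times> 'b) option \<Rightarrow> (real \<times> 'b) option" where
  "cone_scale k = map_option (\<lambda>(r, x). (k * r, x))"

definition cone_mass :: "(real \<times> 'b) option \<Rightarrow> real" where
  "cone_mass u = (case u of None \<Rightarrow> 0 | Some (r, x) \<Rightarrow> r)"

lemma cone_simps [simp]:
  "carrier (cone_monoid B pl) = insert None (Some ` ({0<..} \<times> B))"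
  "mult (cone_monoid B pl) = cone_add pl"
  "one (cone_monoid B pl) = None"
  by (simp_all add: cone_monoid_def)

text \<open>Weights in the cone are shares of mass. Rebracketing a sum of three multiples keeps
  these shares, which is the associativity axiom of \<open>pl\<close>; commutativity holds because
  the shares of two summands are complementary.\<close>

lemma comm_monoid_cone:
  assumes "convex_algebra B pl"
  shows "comm_monoid (cone_monoid B pl)"
proof -
  have closed: "\<And>p x y. 0 < p \<Longrightarrow> p < 1 \<Longrightarrow> x \<in> B \<Longrightarrow> y \<in> B \<Longrightarrow> pl p x y \<in> B"
    and comm: "\<And>p x y. 0 < p \<Longrightarrow> p < 1 \<Longrightarrow> x \<in> B \<Longrightarrow> y \<in> B \<Longrightarrow> pl p x y = pl (1 - p) y x"
    and assoc: "\<And>p q x y z. 0 < p \<Longrightarrow> p < 1 \<Longrightarrow> 0 < q \<Longrightarrow> q < 1 \<Longrightarrow> x \<in> B \<Longrightarrow> y \<in> B \<Longrightarrow> z \<in> B \<Longrightarrow>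
        pl p (pl q x y) z = pl (p * q) x (pl (p * (1 - q) / (1 - p * q)) y z)"
    using assms unfolding convex_algebra_def by (meson greaterThanLessThan_iff)+
  have assoc': "pl ((r + s) / (r + s + t)) (pl (r / (r + s)) x y) z
      = pl (r / (r + (s + t))) x (pl (s / (s + t)) y z)"
    if "0 < r" "0 < s" "0 < t" "x \<in> B" "y \<in> B" "z \<in> B" for r s t x y z
  proof -
    \<comment> \<open>\<open>?p * ?q\<close> is the share of \<open>r\<close> in the total mass, and
      in the inner weight of the axiom the total cancels, leaving
      \<open>s / (s + t)\<close>.\<close>
    let ?p = "(r + s) / (r + s + t)" and ?q = "r / (r + s)"
    have pq: "?p * ?q = r / (r + (s + t))" using that by (simp add: add.assoc)
    have "1 - ?q = s / (r + s)" using that by (simp add: field_simps)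
    then have num: "?p * (1 - ?q) = s / (r + s + t)" using that by simp
    have den: "1 - r / (r + (s + t)) = (s + t) / (r + s + t)" using that by (simp add: field_simps)
    have "?p * (1 - ?q) / (1 - ?p * ?q) = s / (s + t)"
      unfolding num pq den using that by simp
    with pq show ?thesis using assoc[of ?p ?q x y z] that by (simp add: add.assoc)
  qed
  have comm': "pl (r / (r + s)) x y = pl (s / (s + r)) y x"
    if "0 < r" "0 < s" "x \<in> B" "y \<in> B" for r s x y
  proof -
    have "1 - r / (r + s) = s / (s + r)" using that by (simp add: field_simps)
    then show ?thesis using comm[of "r / (r + s)" x y] that by simp
  qed
  show ?thesis
    by (rule comm_monoidI) (auto simp: closed assoc' intro: comm')
qed

lemma cone_pt_closed: "0 \<le> r \<Longrightarrow> x \<in> B \<Longrightarrow> cone_pt r x \<in> carrier (cone_monoid B pl)"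
  by (auto simp: cone_pt_def)

text \<open>Idempotence of \<open>pl\<close> is what makes multiples of one point additive in the
  coefficient.\<close>

lemma cone_pt_add:
  assumes "convex_algebra B pl" "0 \<le> r" "0 \<le> s" "x \<in> B"
  shows "cone_pt (r + s) x = cone_add pl (cone_pt r x) (cone_pt s x)"
proof -
  have "pl p x x = x" if "0 < p" "p < 1" for p
    using assms that unfolding convex_algebra_def by (meson greaterThanLessThan_iff)
  then show ?thesis using assms by (auto simp: cone_pt_def)
qed

lemma cone_scale_closed:
  "0 < k \<Longrightarrow> u \<in> carrier (cone_monoid B pl) \<Longrightarrow> cone_scale k u \<in> carrier (cone_monoid B pl)"
  by (auto simp: cone_scale_def)

lemma cone_scale_pt: "0 < k \<Longrightarrow> cone_scale k (cone_pt r x) = cone_pt (k * r) x"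
  by (simp add: cone_scale_def cone_pt_def)

text \<open>A common factor cancels from the ratio of masses, so the weight passed to
  \<open>pl\<close> is unchanged.\<close>

lemma cone_scale_add:
  "0 < k \<Longrightarrow> cone_scale k (cone_add pl u v) = cone_add pl (cone_scale k u) (cone_scale k v)"
  by (cases "(pl, u, v)" rule: cone_add.cases)
    (auto simp: cone_scale_def simp flip: distrib_left)

lemma cone_mass_add: "cone_mass (cone_add pl u v) = cone_mass u + cone_mass v"
  by (cases "(pl, u, v)" rule: cone_add.cases) (auto simp: cone_mass_def)

lemma cone_scale_finprod:
  assumes "convex_algebra B pl" "0 < k" "finite F" "g \<in> F \<rightarrow> carrier (cone_monoid B pl)"
  shows "cone_scale k (finprod (cone_monoid B pl) g F)
    = finprod (cone_monoid B pl) (\<lambda>a. cone_scale k (g a)) F"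
proof -
  interpret comm_monoid "cone_monoid B pl" by (rule comm_monoid_cone) fact
  show ?thesis
    using assms(3,4)
  proof (induction rule: finite_induct)
    case empty
    then show ?case by (simp add: cone_scale_def)
  next
    case (insert a F)
    have "g a \<in> carrier (cone_monoid B pl)" "g \<in> F \<rightarrow> carrier (cone_monoid B pl)"
      "(\<lambda>a. cone_scale k (g a)) \<in> F \<rightarrow> carrier (cone_monoid B pl)"
      "cone_scale k (g a) \<in> carrier (cone_monoid B pl)"
      using insert.prems \<open>0 < k\<close> by (auto simp del: cone_simps intro!: cone_scale_closed)
    then show ?case
      using insert.hyps insert.IH by (simp add: cone_scale_add[OF \<open>0 < k\<close>] del: cone_simps(1))
  qed
qed

text \<open>Mass is a homomorphism from the cone to the additive reals; this later shows that the
  sum attached to a distribution has mass 1.\<close>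

lemma cone_mass_finprod:
  assumes "convex_algebra B pl" "finite F" "g \<in> F \<rightarrow> carrier (cone_monoid B pl)"
  shows "cone_mass (finprod (cone_monoid B pl) g F) = (\<Sum>a\<in>F. cone_mass (g a))"
proof -
  interpret comm_monoid "cone_monoid B pl" by (rule comm_monoid_cone) fact
  show ?thesis
    using assms(2,3)
  proof (induction rule: finite_induct)
    case empty
    then show ?case by (simp add: cone_mass_def)
  next
    case (insert a F)
    have "g a \<in> carrier (cone_monoid B pl)" "g \<in> F \<rightarrow> carrier (cone_monoid B pl)"
      using insert.prems by (auto simp del: cone_simps)
    then show ?case
      using insert.hyps insert.IH by (simp add: cone_mass_add del: cone_simps(1))
  qed
qed

subsection \<open>Barycenters\<close>

definition cone_sum ::
  "'b set \<Rightarrow> (real \<Rightarrow> 'b \<Rightarrow> 'b \<Rightarrow> 'b) \<Rightarrow> ('a \<Rightarrow> 'b) \<Rightarrow> 'a pmf \<Rightarrow> (real \<times> 'b) option" where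
  "cone_sum B pl f \<mu> = finprod (cone_monoid B pl) (\<lambda>a. cone_pt (pmf \<mu> a) (f a)) (set_pmf \<mu>)"

definition barycenter ::
  "'b set \<Rightarrow> (real \<Rightarrow> 'b \<Rightarrow> 'b \<Rightarrow> 'b) \<Rightarrow> ('a \<Rightarrow> 'b) \<Rightarrow> 'a pmf \<Rightarrow> 'b" where
  "barycenter B pl f \<mu> = snd (the (cone_sum B pl f \<mu>))"

text \<open>The added factors are units. This lets two distributions and their mixture share one
  index set.\<close>

lemma cone_sum_superset:
  assumes "convex_algebra B pl" "f \<in> A \<rightarrow> B" "finite F" "set_pmf \<mu> \<subseteq> F" "F \<subseteq> A"
  shows "cone_sum B pl f \<mu> = finprod (cone_monoid B pl) (\<lambda>a. cone_pt (pmf \<mu> a) (f a)) F"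
proof -
  interpret comm_monoid "cone_monoid B pl" by (rule comm_monoid_cone) fact
  have "(\<lambda>a. cone_pt (pmf \<mu> a) (f a)) \<in> F \<rightarrow> carrier (cone_monoid B pl)"
    using assms by (intro Pi_I cone_pt_closed) auto
  then show ?thesis
    unfolding cone_sum_def using assms
    by (intro finprod_mono_neutral_cong_left)
      (auto simp del: cone_simps(1) simp: cone_pt_def set_pmf_iff)
qed

text \<open>The probabilities add up to 1, so the sum has mass 1. This excludes \<open>None\<close>
  and justifies \<open>the\<close> in \<open>barycenter\<close>.\<close>

lemma cone_sum_eq:
  assumes "convex_algebra B pl" "f \<in> A \<rightarrow> B" "\<mu> \<in> fin_distributions A"
  shows "cone_sum B pl f \<mu> = Some (1, barycenter B pl f \<mu>)" "barycenter B pl f \<mu> \<in> B"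
proof -
  interpret comm_monoid "cone_monoid B pl" by (rule comm_monoid_cone) fact
  let ?g = "\<lambda>a. cone_pt (pmf \<mu> a) (f a)"
  have \<mu>: "finite (set_pmf \<mu>)" "set_pmf \<mu> \<subseteq> A"
    using assms(3) by (auto simp: fin_distributions_def)
  have g: "?g \<in> set_pmf \<mu> \<rightarrow> carrier (cone_monoid B pl)"
    using assms \<mu> by (intro Pi_I cone_pt_closed) auto
  have "cone_mass (?g a) = pmf \<mu> a" for a by (simp add: cone_pt_def cone_mass_def)
  then have "cone_mass (cone_sum B pl f \<mu>) = 1"
    unfolding cone_sum_def using cone_mass_finprod[OF assms(1) \<mu>(1) g] \<mu>(1)
    by (simp add: sum_pmf_eq_1)
  moreover have "cone_sum B pl f \<mu> \<in> carrier (cone_monoid B pl)"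
    unfolding cone_sum_def by (rule finprod_closed) (fact g)
  ultimately show "cone_sum B pl f \<mu> = Some (1, barycenter B pl f \<mu>)" "barycenter B pl f \<mu> \<in> B"
    by (auto simp: barycenter_def cone_mass_def)
qed

lemma barycenter_return:
  assumes "convex_algebra B pl" "f a \<in> B"
  shows "barycenter B pl f (return_pmf a) = f a"
proof -
  interpret comm_monoid "cone_monoid B pl" by (rule comm_monoid_cone) fact
  have "cone_pt 1 (f a) \<in> carrier (cone_monoid B pl)" using assms by (intro cone_pt_closed) auto
  then have "cone_sum B pl f (return_pmf a) = cone_pt 1 (f a)"
    by (simp add: cone_sum_def cone_pt_def)
  then show ?thesis by (simp add: barycenter_def cone_pt_def)
qed

text \<open>The cone turns this into linearity: the sum for the mixture splits into the scaled sums
  for \<open>\<mu>\<close> and \<open>\<nu>\<close>.\<close>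

lemma barycenter_mix:
  assumes B: "convex_algebra B pl" and f: "f \<in> A \<rightarrow> B" and p: "0 < p" "p < 1"
    and \<mu>: "\<mu> \<in> fin_distributions A" and \<nu>: "\<nu> \<in> fin_distributions A"
  shows "barycenter B pl f (mix p \<mu> \<nu>) = pl p (barycenter B pl f \<mu>) (barycenter B pl f \<nu>)"
proof -
  let ?C = "cone_monoid B pl" and ?F = "set_pmf \<mu> \<union> set_pmf \<nu>"
  let ?g = "\<lambda>\<kappa> a. cone_pt (pmf \<kappa> a) (f a)"
  interpret comm_monoid ?C by (rule comm_monoid_cone) fact
  have F: "finite ?F" "?F \<subseteq> A" using \<mu> \<nu> by (auto simp: fin_distributions_def)
  have fB: "f a \<in> B" if "a \<in> ?F" for a using that F f by auto
  have g: "?g \<kappa> \<in> ?F \<rightarrow> carrier ?C" for \<kappa> using fB by (intro Pi_I cone_pt_closed) auto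
  have sum: "cone_sum B pl f \<kappa> = finprod ?C (?g \<kappa>) ?F" if "set_pmf \<kappa> \<subseteq> ?F" for \<kappa>
    using cone_sum_superset[OF B f F(1) that F(2)] .
  have sg: "(\<lambda>a. cone_scale k (?g \<kappa> a)) \<in> ?F \<rightarrow> carrier ?C" if "0 < k" for k \<kappa>
    using g that by (auto simp del: cone_simps intro!: cone_scale_closed)
  have "cone_sum B pl f (mix p \<mu> \<nu>) = finprod ?C (?g (mix p \<mu> \<nu>)) ?F"
    using p by (intro sum) (simp add: set_pmf_mix)
  also have "\<dots> = finprod ?C (\<lambda>a. cone_scale p (?g \<mu> a) \<otimes>\<^bsub>?C\<^esub> cone_scale (1 - p) (?g \<nu> a)) ?F"
  proof (rule finprod_cong')
    show "(\<lambda>a. cone_scale p (?g \<mu> a) \<otimes>\<^bsub>?C\<^esub> cone_scale (1 - p) (?g \<nu> a)) \<in> ?F \<rightarrow> carrier ?C"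
      using sg[of p \<mu>] sg[of "1 - p" \<nu>] p by (intro Pi_I m_closed) (auto simp del: cone_simps)
    \<comment> \<open>At a fixed \<open>a\<close> the coefficient is
      \<open>p * pmf \<mu> a + (1 - p) * pmf \<nu> a\<close>; either summand may be 0.\<close>
    show "?g (mix p \<mu> \<nu>) a = cone_scale p (?g \<mu> a) \<otimes>\<^bsub>?C\<^esub> cone_scale (1 - p) (?g \<nu> a)"
      if "a \<in> ?F" for a
      using cone_pt_add[OF B, of "p * pmf \<mu> a" "(1 - p) * pmf \<nu> a" "f a"] p fB[OF that]
      by (simp add: pmf_mix cone_scale_pt)
  qed simp
  also have "\<dots> = finprod ?C (\<lambda>a. cone_scale p (?g \<mu> a)) ?F
      \<otimes>\<^bsub>?C\<^esub> finprod ?C (\<lambda>a. cone_scale (1 - p) (?g \<nu> a)) ?F"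
    using sg p by (intro finprod_multf) auto
  also have "\<dots> = cone_scale p (cone_sum B pl f \<mu>) \<otimes>\<^bsub>?C\<^esub> cone_scale (1 - p) (cone_sum B pl f \<nu>)"
    using cone_scale_finprod[OF B _ F(1) g] p sum by simp
  \<comment> \<open>The masses are now \<open>p\<close> and \<open>1 - p\<close>, with sum 1, so
    \<open>cone_add\<close> applies \<open>pl\<close> with weight exactly \<open>p\<close>.\<close>
  also have "\<dots> = Some (1, pl p (barycenter B pl f \<mu>) (barycenter B pl f \<nu>))"
    by (simp add: cone_sum_eq[OF B f \<mu>] cone_sum_eq[OF B f \<nu>] cone_scale_def)
  finally show ?thesis by (simp add: barycenter_def)
qed

subsection \<open>The universal property\<close>

lemma LK_algebra_convex_left:
  assumes "LK_algebra B \<Delta> pl" "0 < p" "p < 1" "x \<in> B" "y \<in> B" "z \<in> B"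
  shows "\<Delta> (pl p x y) z \<le> p * \<Delta> x z + (1 - p) * \<Delta> y z"
proof -
  \<comment> \<open>Writing \<open>z\<close> as \<open>pl p z z\<close> makes the hypothesis
    applicable; the two copies of \<open>z\<close> then have weights adding up to 1, and four
    distances collapse to two.\<close>
  have "\<Delta> (pl p x y) (pl p z z) \<le> lift_LK p \<Delta> (x, y) (z, z)"
    using assms unfolding LK_algebra_def nonexpansive_def by fastforce
  moreover have "pl p z z = z"
    using assms unfolding LK_algebra_def convex_algebra_def by (meson greaterThanLessThan_iff)
  ultimately show ?thesis
    using assms by (simp add: lift_LK_eq flip: distrib_right)
qed

lemma nonexpansive_barycenter:
  assumes alg: "LK_algebra B \<Delta> pl" and f: "nonexpansive A d B \<Delta> f"
  shows "nonexpansive (fin_distributions A) (LK d) B \<Delta> (barycenter B pl f)"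
proof -
  let ?h = "barycenter B pl f"
  have B: "convex_algebra B pl" and sym: "\<And>x y. x \<in> B \<Longrightarrow> y \<in> B \<Longrightarrow> \<Delta> x y = \<Delta> y x"
    using alg by (auto simp: LK_algebra_def diffuse_metric_space_def)
  have fB: "f \<in> A \<rightarrow> B" and ne: "\<And>a b. a \<in> A \<Longrightarrow> b \<in> A \<Longrightarrow> \<Delta> (f a) (f b) \<le> d a b"
    using f by (auto simp: nonexpansive_def)
  have ret: "?h (return_pmf a) = f a" if "a \<in> A" for a
    using barycenter_return[OF B, of f] fB that by auto
  have hB: "?h \<mu> \<in> B" if "\<mu> \<in> fin_distributions A" for \<mu>
    using cone_sum_eq(2)[OF B fB that] .
  have fin: "finite (set_pmf \<mu>)" if "\<mu> \<in> fin_distributions A" for \<mu>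
    using that by (simp add: fin_distributions_def)
  \<comment> \<open>The bounds \<open>l\<close> and \<open>l'\<close> are left free so that the step
    serves mixtures in either argument of \<open>LK d\<close>.\<close>
  have step: "\<Delta> (?h (mix p \<mu> \<mu>')) (?h \<nu>) \<le> p * l + (1 - p) * l'"
    if "0 < p" "p < 1" "\<mu> \<in> fin_distributions A" "\<mu>' \<in> fin_distributions A"
      "\<nu> \<in> fin_distributions A" "\<Delta> (?h \<mu>) (?h \<nu>) \<le> l" "\<Delta> (?h \<mu>') (?h \<nu>) \<le> l'" for p \<mu> \<mu>' \<nu> l l'
  proof -
    have "\<Delta> (?h (mix p \<mu> \<mu>')) (?h \<nu>) \<le> p * \<Delta> (?h \<mu>) (?h \<nu>) + (1 - p) * \<Delta> (?h \<mu>') (?h \<nu>)"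
      unfolding barycenter_mix[OF B fB that(1-4)]
      using that hB by (intro LK_algebra_convex_left[OF alg]) auto
    also have "\<dots> \<le> p * l + (1 - p) * l'" using that by (intro add_mono mult_left_mono) auto
    finally show ?thesis .
  qed
  have "\<Delta> (?h \<mu>) (?h \<nu>) \<le> LK d \<mu> \<nu>"
    if \<mu>: "\<mu> \<in> fin_distributions A" and \<nu>: "\<nu> \<in> fin_distributions A" for \<mu> \<nu>
    using \<mu>
  proof (induction rule: fin_distributions_induct)
    case (return a)
    note a = return_pmf_fin_distributions[OF return]
    from \<nu> show ?case
    proof (induction rule: fin_distributions_induct)
      case (return b)
      then show ?case using \<open>a \<in> A\<close> ne by (simp add: ret LK_return)
    next
      case (mix p \<nu> \<nu>')
      \<comment> \<open>The step treats a mixture in the first argument of \<open>\<Delta>\<close>,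
        so symmetry of \<open>\<Delta>\<close> moves it there and back.\<close>
      have "\<Delta> (?h (mix p \<nu> \<nu>')) (?h (return_pmf a))
          \<le> p * LK d (return_pmf a) \<nu> + (1 - p) * LK d (return_pmf a) \<nu>'"
        using mix a hB sym by (intro step) auto
      also have "\<dots> = LK d (return_pmf a) (mix p \<nu> \<nu>')"
        using mix a fin by (simp add: LK_mix_right)
      finally show ?case
        using sym mix a hB mix_fin_distributions[OF mix(1-4)] by metis
    qed
  next
    case (mix p \<mu> \<mu>')
    then have "\<Delta> (?h (mix p \<mu> \<mu>')) (?h \<nu>) \<le> p * LK d \<mu> \<nu> + (1 - p) * LK d \<mu>' \<nu>"
      using \<nu> by (intro step) auto
    then show ?case using mix \<nu> fin by (simp add: LK_mix_left)
  qed
  then show ?thesis using hB by (auto simp: nonexpansive_def)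
qed

lemma LK_hom_unique:
  assumes h: "LK_hom (fin_distributions A) (LK d) mix B \<Delta> pl h"
    and h': "LK_hom (fin_distributions A) (LK d) mix B \<Delta> pl h'"
    and eq: "\<And>a. a \<in> A \<Longrightarrow> h (return_pmf a) = h' (return_pmf a)"
    and \<mu>: "\<mu> \<in> fin_distributions A"
  shows "h \<mu> = h' \<mu>"
  using \<mu>
proof (induction rule: fin_distributions_induct)
  case (return a)
  then show ?case by (rule eq)
next
  case (mix p \<mu> \<nu>)
  then show ?case using h h' by (simp add: LK_hom_def)
qed

theorem theorem5p6:
  fixes A :: "'a set" and d :: "'a \<Rightarrow> 'a \<Rightarrow> real"
  assumes "diffuse_metric_space A d"
  shows "LK_algebra (fin_distributions A) (LK d) mix \<and>
         nonexpansive A d (fin_distributions A) (LK d) return_pmf \<and>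
         (\<forall>(B :: 'b set) \<Delta> pl f.
            LK_algebra B \<Delta> pl \<longrightarrow> nonexpansive A d B \<Delta> f \<longrightarrow>
            (\<exists>!h. h \<in> extensional (fin_distributions A) \<and>
                  LK_hom (fin_distributions A) (LK d) mix B \<Delta> pl h \<and>
                  (\<forall>a\<in>A. h (return_pmf a) = f a)))"
proof (intro conjI allI impI)
  show "LK_algebra (fin_distributions A) (LK d) mix"
    using assms by (rule LK_algebra_fin_distributions)
  show "nonexpansive A d (fin_distributions A) (LK d) return_pmf"
    by (simp add: nonexpansive_def LK_return return_pmf_fin_distributions)
next
  fix B :: "'b set" and \<Delta> pl f
  assume alg: "LK_algebra B \<Delta> pl" and f: "nonexpansive A d B \<Delta> f"
  let ?D = "fin_distributions A"
  \<comment> \<open>Maps are total functions, so the witness is made \<open>undefined\<close> off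
    \<open>?D\<close>; uniqueness is then equality of functions.\<close>
  let ?h = "restrict (barycenter B pl f) ?D"
  have B: "convex_algebra B pl" and fB: "f \<in> A \<rightarrow> B"
    using alg f by (auto simp: LK_algebra_def nonexpansive_def)
  have hom: "LK_hom ?D (LK d) mix B \<Delta> pl ?h"
    using nonexpansive_barycenter[OF alg f] barycenter_mix[OF B fB] mix_fin_distributions[of _ _ A]
    by (auto simp: LK_hom_def nonexpansive_def)
  have ret: "\<forall>a\<in>A. ?h (return_pmf a) = f a"
    using barycenter_return[OF B, of f] fB by (auto simp: return_pmf_fin_distributions)
  show "\<exists>!h. h \<in> extensional ?D \<and> LK_hom ?D (LK d) mix B \<Delta> pl h \<and> (\<forall>a\<in>A. h (return_pmf a) = f a)"
  proof (rule ex1I[of _ ?h])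
    show "?h \<in> extensional ?D \<and> LK_hom ?D (LK d) mix B \<Delta> pl ?h \<and> (\<forall>a\<in>A. ?h (return_pmf a) = f a)"
      using hom ret by simp
    fix h
    assume h: "h \<in> extensional ?D \<and> LK_hom ?D (LK d) mix B \<Delta> pl h \<and> (\<forall>a\<in>A. h (return_pmf a) = f a)"
    show "h = ?h"
    proof (rule extensionalityI)
      show "h \<in> extensional ?D" using h by simp
      show "h \<mu> = ?h \<mu>" if "\<mu> \<in> ?D" for \<mu>
        using LK_hom_unique[OF _ hom _ that] h ret by simp
    qed simp
  qed
qed

end
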